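(* Let $S=\langle n_0,\ldots,n_p\rangle$ be a numerical semigroup on a compound sequence (NSCS), with associated integers $a_1,\ldots,a_p,b_1,\ldots,b_p$. Then the catenary degree of $S$ is $c(S)=\max\{b_1,b_2,\ldots,b_p\}$.
   Context: Let $\mathbb{N}$ be the positive integers and $\mathbb{N}_0$ the nonnegative integers. A compound sequence is a sequence $\{n_0,\ldots,n_p\}$ with $n_i=b_1b_2\cdots b_i\,a_{i+1}a_{i+2}\cdots a_p$ for $i\in[0,p]$, where $p,a_1,\ldots,a_p,b_1,\ldots,b_p\in\mathbb{N}$ satisfy $2\le a_i<b_i$ for all $i\in[1,p]$ and $\gcd(a_i,b_j)=1$ for all $i,j\in[1,p]$ with $i\ge j$. An NSCS is a numerical semigroup $S=\langle n_0,\ldots,n_p\rangle$ whose minimal generators form a compound sequence. The factorization homomorphism is $\phi:\mathbb{N}_0^{p+1}\to S$, $\phi(x_0,\ldots,x_p)=x_0n_0+\cdots+x_pn_p$; the elements of $\phi^{-1}(n)$ are the factorizations of $n$. For $x\in\mathbb{N}_0^{p+1}$, $|x|=x_0+\cdots+x_p$. For $x,y\in\mathbb{N}_0^{p+1}$, $\gcd(x,y)=(\min\{x_0,y_0\},\ldots,\min\{x_p,y_p\})$ and $d(x,y)=\max\{|x-\gcd(x,y)|,|y-\gcd(x,y)|\}$. For $x,y\in\phi^{-1}(n)$, an $N$-chain from $x$ to $y$ is a sequence $x^0,x^1,\ldots,x^k\in\phi^{-1}(n)$ with $x^0=x$, $x^k=y$ and $d(x^i,x^{i+1})\le N$ for all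 $i\in[0,k-1]$. The catenary degree $c(n)$ of $n\in S$ is the minimal $N\in\mathbb{N}_0$ such that for any $x,y\in\phi^{-1}(n)$ there is an $N$-chain from $x$ to $y$, and $c(S)=\sup\{c(n):n\in S\}$. *)

theory Defs
  imports Complex_Main "HOL-Library.Extended_Nat"
begin

definition additive_submonoid :: "nat set \<Rightarrow> bool" where
  "additive_submonoid T \<longleftrightarrow> 0 \<in> T \<and> (\<forall>x\<in>T. \<forall>y\<in>T. x + y \<in> T)"

definition generated :: "nat set \<Rightarrow> nat set" where
  "generated A = additive_submonoid hull A"

definition numerical_semigroup :: "nat set \<Rightarrow> bool" where
  "numerical_semigroup S \<longleftrightarrow> additive_submonoid S \<and> finite (- S)"

definition minimal_generators :: "nat set \<Rightarrow> nat set \<Rightarrow> bool" where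
  "minimal_generators A S \<longleftrightarrow> generated A = S \<and> (\<forall>B. B \<subset> A \<longrightarrow> generated B \<noteq> S)"

text \<open>Sequences indexed by \<open>[1,p]\<close> or \<open>[0,p]\<close> are functions on \<^typ>\<open>nat\<close>
  of which only the values on that range matter.\<close>

definition compound_params :: "nat \<Rightarrow> (nat \<Rightarrow> nat) \<Rightarrow> (nat \<Rightarrow> nat) \<Rightarrow> bool" where
  "compound_params p a b \<longleftrightarrow>
     1 \<le> p \<and>
     (\<forall>i\<in>{1..p}. 2 \<le> a i \<and> a i < b i) \<and>
     (\<forall>i\<in>{1..p}. \<forall>j\<in>{1..p}. j \<le> i \<longrightarrow> gcd (a i) (b j) = 1)"

definition compound_seq :: "nat \<Rightarrow> (nat \<Rightarrow> nat) \<Rightarrow> (nat \<Rightarrow> nat) \<Rightarrow> nat \<Rightarrow> nat" where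
  "compound_seq p a b i = (\<Prod>j = 1..i. b j) * (\<Prod>j = i + 1..p. a j)"

definition NSCS :: "nat set \<Rightarrow> nat \<Rightarrow> (nat \<Rightarrow> nat) \<Rightarrow> (nat \<Rightarrow> nat) \<Rightarrow> bool" where
  "NSCS S p a b \<longleftrightarrow>
     numerical_semigroup S \<and>
     compound_params p a b \<and>
     minimal_generators (compound_seq p a b ` {0..p}) S"

text \<open>Vectors in \<open>\<nat>\<^sub>0\<^bsup>p+1\<^esup>\<close> are functions vanishing outside \<open>[0,p]\<close>.\<close>

definition vectors :: "nat \<Rightarrow> (nat \<Rightarrow> nat) set" where
  "vectors p = {x. \<forall>i>p. x i = 0}"

definition factorization_hom :: "nat \<Rightarrow> (nat \<Rightarrow> nat) \<Rightarrow> (nat \<Rightarrow> nat) \<Rightarrow> nat" where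
  "factorization_hom p n x = (\<Sum>i = 0..p. x i * n i)"

definition factorizations :: "nat \<Rightarrow> (nat \<Rightarrow> nat) \<Rightarrow> nat \<Rightarrow> (nat \<Rightarrow> nat) set" where
  "factorizations p n m = {x \<in> vectors p. factorization_hom p n x = m}"

definition vec_size :: "nat \<Rightarrow> (nat \<Rightarrow> nat) \<Rightarrow> nat" where
  "vec_size p x = (\<Sum>i = 0..p. x i)"

definition vec_gcd :: "(nat \<Rightarrow> nat) \<Rightarrow> (nat \<Rightarrow> nat) \<Rightarrow> nat \<Rightarrow> nat" where
  "vec_gcd x y = (\<lambda>i. min (x i) (y i))"

text \<open>The subtractions below do not truncate, since \<^term>\<open>vec_gcd x y\<close> is
  componentwise at most \<open>x\<close> and \<open>y\<close>.\<close>

definition vec_dist :: "nat \<Rightarrow> (nat \<Rightarrow> nat) \<Rightarrow> (nat \<Rightarrow> nat) \<Rightarrow> nat" where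
  "vec_dist p x y =
     max (vec_size p (\<lambda>i. x i - vec_gcd x y i)) (vec_size p (\<lambda>i. y i - vec_gcd x y i))"

definition has_chain ::
  "nat \<Rightarrow> (nat \<Rightarrow> nat) \<Rightarrow> nat \<Rightarrow> nat \<Rightarrow> (nat \<Rightarrow> nat) \<Rightarrow> (nat \<Rightarrow> nat) \<Rightarrow> bool" where
  "has_chain p n m N x y \<longleftrightarrow>
     (\<exists>(k::nat) z. z 0 = x \<and> z k = y \<and>
        (\<forall>i\<le>k. z i \<in> factorizations p n m) \<and>
        (\<forall>i<k. vec_dist p (z i) (z (i + 1)) \<le> N))"

text \<open>For positive generators every element has finitely many factorizations, so a
  suitable \<open>N\<close> exists and \<^const>\<open>Least\<close> is a genuine minimum.\<close>

definition catenary_degree :: "nat \<Rightarrow> (nat \<Rightarrow> nat) \<Rightarrow> nat \<Rightarrow> nat" where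
  "catenary_degree p n m =
     (LEAST N. \<forall>x\<in>factorizations p n m. \<forall>y\<in>factorizations p n m. has_chain p n m N x y)"

text \<open>The supremum is taken in \<^typ>\<open>enat\<close>, where it exists without assuming
  boundedness.\<close>

definition semigroup_catenary_degree :: "nat \<Rightarrow> (nat \<Rightarrow> nat) \<Rightarrow> nat set \<Rightarrow> enat" where
  "semigroup_catenary_degree p n S = (SUP m\<in>S. enat (catenary_degree p n m))"

end

theory Submission
  imports Defs "HOL-Number_Theory.Cong"
begin

text \<open>
  Consecutive generators satisfy \<open>a\<^sub>i n\<^sub>i = b\<^sub>i n\<^bsub>i-1\<^esub>\<close>.  Trading \<open>b\<^sub>i\<close> copies of
  \<open>n\<^bsub>i-1\<^esub>\<close> for \<open>a\<^sub>i\<close> copies of \<open>n\<^sub>i\<close> is a step of distance at most \<open>b\<^sub>i\<close> that shortens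
  the factorization, so every factorization is joined by such steps to one with
  \<open>x\<^bsub>i-1\<^esub> < b\<^sub>i\<close> for all \<open>i\<close>.  Reducing modulo \<open>b\<^sub>1\<close>, then \<open>b\<^sub>2\<close>, and so on shows that there is only one
  such factorization, whence \<open>c(S) \<le> max b\<^sub>i\<close>.

  Conversely let \<open>m = b\<^sub>i n\<^bsub>i-1\<^esub> = A B\<close> with \<open>A = a\<^sub>i \<cdots> a\<^sub>p\<close> and \<open>B = b\<^sub>1 \<cdots> b\<^sub>i\<close> coprime.
  In a factorization of \<open>m\<close>, the part contributed by the generators below index \<open>i\<close> is divisible
  by \<open>A\<close> and, its complement being divisible by \<open>B\<close>, also by \<open>B\<close>; so it is \<open>0\<close> or \<open>m\<close>.  Both
  kinds of factorization occur, they have disjoint supports, and those using only indices below \<open>i\<close>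
  have length at least \<open>b\<^sub>i\<close>, so every chain between the two kinds has a step of distance at least
  \<open>b\<^sub>i\<close>.
\<close>

section \<open>Chains of factorizations\<close>

definition chain_step :: "nat \<Rightarrow> (nat \<Rightarrow> nat) \<Rightarrow> nat \<Rightarrow> nat \<Rightarrow> (nat \<Rightarrow> nat) \<Rightarrow> (nat \<Rightarrow> nat) \<Rightarrow> bool" where
  "chain_step p n m N x y \<longleftrightarrow>
     x \<in> factorizations p n m \<and> y \<in> factorizations p n m \<and> vec_dist p x y \<le> N"

lemma vec_dist_commute: "vec_dist p x y = vec_dist p y x"
  by (simp add: vec_dist_def vec_gcd_def max.commute min.commute)

lemma symp_chain_step: "symp (chain_step p n m N)"
  by (auto simp: symp_def chain_step_def vec_dist_commute)

text \<open>The conjunct on \<open>x\<close> takes care of the chain with no steps, which the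
  closure of \<open>chain_step\<close> allows for every \<open>x\<close>.\<close>

lemma has_chain_iff_rtranclp:
  "has_chain p n m N x y \<longleftrightarrow>
     x \<in> factorizations p n m \<and> (chain_step p n m N)\<^sup>*\<^sup>* x y"
proof
  assume "has_chain p n m N x y"
  then show "x \<in> factorizations p n m \<and> (chain_step p n m N)\<^sup>*\<^sup>* x y"
    unfolding has_chain_def
  proof (elim exE conjE)
    fix k :: nat and z
    assume z: "z 0 = x" "z k = y" "\<forall>i\<le>k. z i \<in> factorizations p n m"
      "\<forall>i<k. vec_dist p (z i) (z (i + 1)) \<le> N"
    then have "\<forall>i<k. chain_step p n m N (z i) (z (Suc i))"
      by (simp add: chain_step_def)
    then have "(chain_step p n m N ^^ k) x y"
      unfolding relpowp_fun_conv using z(1,2) by (intro exI[of _ z]) simp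
    then show ?thesis
      using z(1,3) by (auto intro: relpowp_imp_rtranclp)
  qed
next
  assume *: "x \<in> factorizations p n m \<and> (chain_step p n m N)\<^sup>*\<^sup>* x y"
  then obtain k where "(chain_step p n m N ^^ k) x y"
    by (auto dest: rtranclp_imp_relpowp)
  then show "has_chain p n m N x y"
    unfolding relpowp_fun_conv
  proof (elim exE conjE)
    fix z
    assume z: "z 0 = x" "z k = y" "\<forall>i<k. chain_step p n m N (z i) (z (Suc i))"
    have "z i \<in> factorizations p n m" if "i \<le> k" for i
    proof (cases i)
      case 0
      then show ?thesis
        using * z(1) by simp
    next
      case (Suc j)
      then have "chain_step p n m N (z j) (z i)"
        using z(3) that by simp
      then show ?thesis
        by (simp add: chain_step_def)
    qed
    with z show ?thesis
      unfolding has_chain_def by (intro exI[of _ k] exI[of _ z]) (simp add: chain_step_def)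
  qed
qed

text \<open>Used to locate the step at which a chain passes from one kind of factorization to the
  other.\<close>

lemma rtranclp_crossing:
  assumes "R\<^sup>*\<^sup>* x y" "P x" "\<not> P y"
  shows "\<exists>u v. R u v \<and> P u \<and> \<not> P v"
  using assms by (induction rule: rtranclp_induct) auto

section \<open>Adding multiples of unit vectors\<close>

definition unit_vec :: "nat \<Rightarrow> nat \<Rightarrow> nat \<Rightarrow> nat" where
  "unit_vec j c = (\<lambda>k. if k = j then c else 0)"

lemma factorization_hom_add_unit_vec:
  assumes "j \<le> p"
  shows "factorization_hom p n (\<lambda>k. z k + unit_vec j c k) = factorization_hom p n z + c * n j"
proof -
  have "(\<Sum>k = 0..p. unit_vec j c k * n k) = (\<Sum>k = 0..p. if k = j then c * n k else 0)"
    by (rule sum.cong) (auto simp: unit_vec_def)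
  also have "\<dots> = c * n j"
    using assms by simp
  finally show ?thesis
    by (simp add: factorization_hom_def distrib_right sum.distrib)
qed

lemma factorization_hom_unit_vec:
  "j \<le> p \<Longrightarrow> factorization_hom p n (unit_vec j c) = c * n j"
  using factorization_hom_add_unit_vec[of j p n "\<lambda>_. 0" c] by (simp add: factorization_hom_def)

text \<open>Lets the rules for adding unit vectors serve for lengths too.\<close>

lemma vec_size_eq_factorization_hom: "vec_size p x = factorization_hom p (\<lambda>_. 1) x"
  by (simp add: vec_size_def factorization_hom_def)

lemma vec_size_mono: "(\<And>i. x i \<le> y i) \<Longrightarrow> vec_size p x \<le> vec_size p y"
  unfolding vec_size_def by (rule sum_mono)

text \<open>The common summand \<open>z\<close> lies below the gcd, so removing the gcd leaves at
  most \<open>u\<close> and \<open>v\<close>.\<close>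

lemma vec_dist_add_left_le:
  "vec_dist p (\<lambda>k. z k + u k) (\<lambda>k. z k + v k) \<le> max (vec_size p u) (vec_size p v)"
  unfolding vec_dist_def
  by (intro max.mono vec_size_mono) (auto simp: vec_gcd_def)

lemma vec_dist_disjoint_ge:
  assumes "\<And>i. u i = 0 \<or> v i = 0"
  shows "vec_size p u \<le> vec_dist p u v"
proof -
  have "vec_gcd u v = (\<lambda>_. 0)"
  proof
    show "vec_gcd u v i = 0" for i
      using assms[of i] by (auto simp: vec_gcd_def)
  qed
  then show ?thesis
    by (simp add: vec_dist_def)
qed

section \<open>Compound sequences\<close>

context
  fixes p :: nat and a b :: "nat \<Rightarrow> nat"
  assumes params: "compound_params p a b"
begin

private abbreviation (input) n :: "nat \<Rightarrow> nat" where
  "n \<equiv> compound_seq p a b"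

lemma a_pos: "1 \<le> i \<Longrightarrow> i \<le> p \<Longrightarrow> 0 < a i"
  using params unfolding compound_params_def
  by (metis atLeastAtMost_iff not_gr_zero not_numeral_le_zero)

lemma a_less_b: "1 \<le> i \<Longrightarrow> i \<le> p \<Longrightarrow> a i < b i"
  using params by (simp add: compound_params_def)

lemma b_pos: "1 \<le> i \<Longrightarrow> i \<le> p \<Longrightarrow> 0 < b i"
  using a_less_b[of i] by simp

lemma coprime_a_b: "1 \<le> j \<Longrightarrow> j \<le> i \<Longrightarrow> i \<le> p \<Longrightarrow> coprime (a i) (b j)"
  using params by (simp add: compound_params_def coprime_iff_gcd_eq_1)

lemma compound_seq_pos: "i \<le> p \<Longrightarrow> 0 < n i"
  unfolding compound_seq_def
  by (intro mult_pos_pos prod_pos) (auto intro: a_pos b_pos)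

lemma compound_seq_factor:
  "b (Suc k) * n k = (\<Prod>j = 1..Suc k. b j) * (\<Prod>j = Suc k..p. a j)"
  by (simp add: compound_seq_def)

lemma compound_seq_Suc:
  assumes "k < p"
  shows "a (Suc k) * n (Suc k) = b (Suc k) * n k"
  using assms unfolding compound_seq_factor
  by (simp add: compound_seq_def prod.atLeast_Suc_atMost[of "Suc k" p a] mult_ac)

lemma compound_seq_mono:
  assumes "j \<le> k" "k \<le> p"
  shows "n j \<le> n k"
  using assms
proof (induction k rule: dec_induct)
  case (step k)
  have "a (Suc k) * n k \<le> b (Suc k) * n k"
    using a_less_b[of "Suc k"] step.prems by (intro mult_right_mono) auto
  also have "\<dots> = a (Suc k) * n (Suc k)"
    using compound_seq_Suc[of k] step.prems by simp
  finally have "n k \<le> n (Suc k)"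
    using a_pos[of "Suc k"] step.prems by simp
  then show ?case
    using step by simp
qed simp

lemma prod_b_dvd_compound_seq: "i \<le> j \<Longrightarrow> (\<Prod>l = 1..i. b l) dvd n j"
  unfolding compound_seq_def by (intro dvd_mult2 prod_dvd_prod_subset) auto

lemma prod_a_dvd_compound_seq: "j < i \<Longrightarrow> (\<Prod>l = i..p. a l) dvd n j"
  unfolding compound_seq_def by (intro dvd_mult prod_dvd_prod_subset) auto

section \<open>The upper bound\<close>

text \<open>The normal forms under trading upwards; \<open>x p\<close> stays unbounded, as nothing
  lies above \<open>n p\<close> to trade it for.\<close>

definition reduced :: "(nat \<Rightarrow> nat) \<Rightarrow> bool" where
  "reduced x \<longleftrightarrow> (\<forall>k<p. x k < b (Suc k))"

lemma reduced_factorization_unique: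
  assumes x: "x \<in> factorizations p n m" "reduced x"
    and y: "y \<in> factorizations p n m" "reduced y"
  shows "x = y"
proof -
  have "x k = y k" if "k \<le> p" for k
    using that
  proof (induction k rule: less_induct)
    case (less k)
    have split: "(\<Sum>j = 0..p. z j * n j) =
        (\<Sum>j<k. z j * n j) + (z k * n k + (\<Sum>j = Suc k..p. z j * n j))" for z :: "nat \<Rightarrow> nat"
    proof -
      have "{0..p} = {..<k} \<union> {k..p}"
        using less.prems by auto
      then have "(\<Sum>j = 0..p. z j * n j) = (\<Sum>j<k. z j * n j) + (\<Sum>j = k..p. z j * n j)"
        by (simp add: sum.union_disjoint[symmetric] ivl_disj_int)
      then show ?thesis
        using less.prems by (simp add: sum.atLeast_Suc_atMost)
    qed
    have "(\<Sum>j = 0..p. x j * n j) = (\<Sum>j = 0..p. y j * n j)"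
      using x y by (simp add: factorizations_def factorization_hom_def)
    moreover have "(\<Sum>j<k. x j * n j) = (\<Sum>j<k. y j * n j)"
      using less by (intro sum.cong) auto
    ultimately have eq: "x k * n k + (\<Sum>j = Suc k..p. x j * n j) =
        y k * n k + (\<Sum>j = Suc k..p. y j * n j)"
      by (simp add: split)
    show ?case
    proof (cases "k = p")
      \<comment> \<open>No terms remain above the last coordinate, so \<open>eq\<close> determines
        it without a bound.\<close>
      case True
      then show ?thesis
        using eq compound_seq_pos[of p] by simp
    next
      case False
      then have k: "k < p"
        using less.prems by simp
      define B where "B = (\<Prod>l = 1..k. b l)"
      define A where "A = (\<Prod>l = Suc k..p. a l)"
      have nk: "n k = B * A"
        by (simp add: compound_seq_def A_def B_def)
      have B: "0 < B"
        using compound_seq_pos[of k] k nk by simp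
      have dvd: "B * b (Suc k) dvd (\<Sum>j = Suc k..p. z j * n j)" for z :: "nat \<Rightarrow> nat"
        using prod_b_dvd_compound_seq[of "Suc k"] by (intro dvd_sum dvd_mult) (simp add: B_def)
      \<comment> \<open>The modulus divides every generator above index \<open>k\<close>, so only
        \<open>z * n k\<close> survives; its factor \<open>B\<close> is shared with the modulus and
        comes out.\<close>
      have mod: "(z * n k + (\<Sum>j = Suc k..p. w j * n j)) mod (B * b (Suc k)) =
          B * (z * A mod b (Suc k))" for z :: nat and w :: "nat \<Rightarrow> nat"
      proof -
        have "(z * n k + (\<Sum>j = Suc k..p. w j * n j)) mod (B * b (Suc k)) =
            (z * n k) mod (B * b (Suc k))"
          using dvd[of w] by (elim dvdE) simp
        also have "\<dots> = (B * (z * A)) mod (B * b (Suc k))"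
          by (simp only: nk mult.left_commute)
        finally show ?thesis
          by (simp only: mod_mult_mult1)
      qed
      have "B * (x k * A mod b (Suc k)) = B * (y k * A mod b (Suc k))"
        using eq mod by metis
      then have "[x k * A = y k * A] (mod b (Suc k))"
        using B by (simp add: cong_def)
      \<comment> \<open>The factors of \<open>A\<close> have indices at least \<open>Suc k\<close>,
        just where \<open>a\<close> is known to be coprime to \<open>b (Suc k)\<close>.\<close>
      moreover have "coprime A (b (Suc k))"
        unfolding A_def by (intro prod_coprime_left coprime_a_b) auto
      ultimately have "[x k = y k] (mod b (Suc k))"
        by (simp add: cong_mult_rcancel_nat)
      then show ?thesis
        using x(2) y(2) k by (simp add: reduced_def cong_less_modulus_unique_nat)
    qed
  qed
  moreover have "x k = y k" if "\<not> k \<le> p" for k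
    using x y that by (simp add: factorizations_def vectors_def)
  ultimately show ?thesis
    by blast
qed

lemma ex_chain_to_reduced:
  assumes "\<And>i. 1 \<le> i \<Longrightarrow> i \<le> p \<Longrightarrow> b i \<le> N" "x \<in> factorizations p n m"
  shows "\<exists>y. reduced y \<and> y \<in> factorizations p n m \<and> (chain_step p n m N)\<^sup>*\<^sup>* x y"
  using assms(2)
proof (induction "vec_size p x" arbitrary: x rule: less_induct)
  case less
  show ?case
  proof (cases "reduced x")
    case True
    then show ?thesis
      using less.prems by blast
  next
    case False
    then obtain k where k: "k < p" "b (Suc k) \<le> x k"
      by (auto simp: reduced_def not_less)
    \<comment> \<open>\<open>z\<close> is what the trade leaves untouched: \<open>x\<close> and its
      successor \<open>y\<close> arise from it by adding one unit vector each.\<close>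
    define z where "z = x(k := x k - b (Suc k))"
    define y where "y = (\<lambda>j. z j + unit_vec (Suc k) (a (Suc k)) j)"
    have x: "x = (\<lambda>j. z j + unit_vec k (b (Suc k)) j)"
      using k by (auto simp: z_def unit_vec_def)
    have ab: "a (Suc k) < b (Suc k)"
      using a_less_b[of "Suc k"] k by simp
    have y_fact: "y \<in> factorizations p n m"
    proof -
      have "y \<in> vectors p"
        using less.prems k by (auto simp: y_def z_def unit_vec_def factorizations_def vectors_def)
      moreover have "factorization_hom p n y = factorization_hom p n x"
        using k compound_seq_Suc[of k] unfolding x y_def
        by (simp add: factorization_hom_add_unit_vec)
      ultimately show ?thesis
        using less.prems by (simp add: factorizations_def)
    qed
    have "vec_size p y < vec_size p x"
      using k ab unfolding x y_def vec_size_eq_factorization_hom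
      by (simp add: factorization_hom_add_unit_vec)
    then obtain w where w: "reduced w" "w \<in> factorizations p n m" "(chain_step p n m N)\<^sup>*\<^sup>* y w"
      using less.hyps y_fact by blast
    have "vec_dist p x y \<le> max (b (Suc k)) (a (Suc k))"
      using vec_dist_add_left_le[of p z "unit_vec k (b (Suc k))" "unit_vec (Suc k) (a (Suc k))"] k
      unfolding x[symmetric] y_def[symmetric] vec_size_eq_factorization_hom
      by (simp add: factorization_hom_unit_vec)
    then have "chain_step p n m N x y"
      using assms(1)[of "Suc k"] k ab less.prems y_fact by (simp add: chain_step_def)
    then show ?thesis
      using w by (meson converse_rtranclp_into_rtranclp)
  qed
qed

lemma has_chain_compound_seq:
  assumes "\<And>i. 1 \<le> i \<Longrightarrow> i \<le> p \<Longrightarrow> b i \<le> N"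
    and "x \<in> factorizations p n m" "y \<in> factorizations p n m"
  shows "has_chain p n m N x y"
proof -
  obtain u where u: "reduced u" "u \<in> factorizations p n m" "(chain_step p n m N)\<^sup>*\<^sup>* x u"
    using ex_chain_to_reduced assms by blast
  obtain v where v: "reduced v" "v \<in> factorizations p n m" "(chain_step p n m N)\<^sup>*\<^sup>* y v"
    using ex_chain_to_reduced assms by blast
  have "u = v"
    using reduced_factorization_unique u v by blast
  moreover have "(chain_step p n m N)\<^sup>*\<^sup>* v y"
    using v(3) symp_rtranclp[OF symp_chain_step] by (blast dest: sympD)
  ultimately show ?thesis
    using u assms by (auto simp: has_chain_iff_rtranclp)
qed

lemma catenary_degree_le:
  assumes "\<And>i. 1 \<le> i \<Longrightarrow> i \<le> p \<Longrightarrow> b i \<le> N"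
  shows "catenary_degree p n m \<le> N"
  unfolding catenary_degree_def by (intro Least_le ballI has_chain_compound_seq assms)

lemma has_chain_catenary_degree:
  assumes "x \<in> factorizations p n m" "y \<in> factorizations p n m"
  shows "has_chain p n m (catenary_degree p n m) x y"
proof -
  let ?Q = "\<lambda>N. \<forall>x\<in>factorizations p n m. \<forall>y\<in>factorizations p n m. has_chain p n m N x y"
  \<comment> \<open>\<open>LeastI\<close> needs one admissible bound; the maximum of the
    \<open>b i\<close> is one, for every \<open>m\<close>.\<close>
  have "?Q (Max (b ` {1..p}))"
    using has_chain_compound_seq by simp
  then have "?Q (catenary_degree p n m)"
    unfolding catenary_degree_def by (rule LeastI)
  then show ?thesis
    using assms by blast
qed

section \<open>The lower bound\<close>

lemma factorization_dichotomy:
  assumes k: "k < p" and x: "x \<in> factorizations p n (b (Suc k) * n k)"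
  shows "(\<forall>j\<le>k. x j = 0) \<or> (\<forall>j>k. x j = 0)"
proof -
  define B where "B = (\<Prod>l = 1..Suc k. b l)"
  define A where "A = (\<Prod>l = Suc k..p. a l)"
  define L where "L = (\<Sum>j = 0..k. x j * n j)"
  define U where "U = (\<Sum>j = Suc k..p. x j * n j)"
  have "{0..p} = {0..k} \<union> {Suc k..p}"
    using k by auto
  then have "(\<Sum>j = 0..p. x j * n j) = L + U"
    by (simp add: L_def U_def sum.union_disjoint)
  then have LU: "L + U = B * A"
    using x compound_seq_factor[of k]
    by (simp add: factorizations_def factorization_hom_def A_def B_def)
  have "A dvd L"
    unfolding L_def A_def by (intro dvd_sum dvd_mult prod_a_dvd_compound_seq) auto
  moreover have "B dvd U"
    unfolding U_def B_def by (intro dvd_sum dvd_mult prod_b_dvd_compound_seq) auto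
  then have "B dvd L"
    using LU by (metis dvd_add_left_iff dvd_triv_left)
  moreover have "coprime B A"
    \<comment> \<open>Indices in \<open>B\<close> are at most \<open>Suc k\<close> and those in
      \<open>A\<close> at least \<open>Suc k\<close>, so \<open>coprime_a_b\<close> applies to each
      pair.\<close>
    unfolding A_def B_def
    by (intro prod_coprime_left prod_coprime_right coprime_imp_coprime[OF coprime_a_b]) auto
  ultimately have "B * A dvd L"
    by (simp add: divides_mult)
  then have "L = 0 \<or> L = B * A"
    using LU by (metis dvd_imp_le le_add1 le_antisym not_gr_zero)
  then have "L = 0 \<or> U = 0"
    using LU by auto
  then show ?thesis
  proof
    assume "L = 0"
    then have "x j = 0" if "j \<le> k" for j
      using that k compound_seq_pos[of j] by (auto simp: L_def)
    then show ?thesis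
      by blast
  next
    assume "U = 0"
    then have "x j = 0" if "k < j" "j \<le> p" for j
      using that compound_seq_pos[of j] by (auto simp: U_def)
    moreover have "x j = 0" if "p < j" for j
      using x that by (simp add: factorizations_def vectors_def)
    ultimately show ?thesis
      by (meson not_less)
  qed
qed

text \<open>By monotonicity each generator used is at most \<open>n k\<close>, so reaching
  \<open>b (Suc k) * n k\<close> takes at least \<open>b (Suc k)\<close> of them.\<close>

lemma vec_size_lower_factorization_ge:
  assumes k: "k < p" and x: "x \<in> factorizations p n (b (Suc k) * n k)" "\<forall>j>k. x j = 0"
  shows "b (Suc k) \<le> vec_size p x"
proof -
  have "b (Suc k) * n k = (\<Sum>j = 0..p. x j * n j)"
    using x by (simp add: factorizations_def factorization_hom_def)
  also have "\<dots> \<le> (\<Sum>j = 0..p. x j * n k)"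
  proof (rule sum_mono)
    show "x j * n j \<le> x j * n k" for j
      using x(2) k compound_seq_mono[of j k] by (cases "j \<le> k") auto
  qed
  also have "\<dots> = vec_size p x * n k"
    by (simp add: vec_size_def sum_distrib_right)
  finally show ?thesis
    using compound_seq_pos[of k] k by simp
qed

lemma catenary_degree_ge:
  assumes k: "k < p"
  shows "b (Suc k) \<le> catenary_degree p n (b (Suc k) * n k)"
proof -
  define m where "m = b (Suc k) * n k"
  define x where "x = unit_vec k (b (Suc k))"
  define y where "y = unit_vec (Suc k) (a (Suc k))"
  let ?c = "catenary_degree p n m"
  \<comment> \<open>\<open>P\<close> singles out the factorizations supported on indices up to
    \<open>k\<close>; \<open>x\<close> is one and \<open>y\<close> is not.\<close>
  define P :: "(nat \<Rightarrow> nat) \<Rightarrow> bool" where "P z \<longleftrightarrow> (\<forall>j>k. z j = 0)" for z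
  have "x \<in> factorizations p n m"
    using k by (auto simp: factorizations_def vectors_def x_def m_def factorization_hom_unit_vec)
      (simp add: unit_vec_def)
  moreover have "y \<in> factorizations p n m"
    using k compound_seq_Suc[OF k]
    by (auto simp: factorizations_def vectors_def y_def m_def factorization_hom_unit_vec)
      (simp add: unit_vec_def)
  ultimately have "(chain_step p n m ?c)\<^sup>*\<^sup>* x y"
    using has_chain_catenary_degree by (simp add: has_chain_iff_rtranclp)
  moreover have "P x"
    by (simp add: P_def x_def unit_vec_def)
  moreover have "\<not> P y"
    using a_pos[of "Suc k"] k by (auto simp: P_def y_def unit_vec_def intro!: exI[of _ "Suc k"])
  ultimately obtain u v where uv: "chain_step p n m ?c u v" "P u" "\<not> P v"
    using rtranclp_crossing[of _ x y P] by blast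
  then have fact: "u \<in> factorizations p n m" "v \<in> factorizations p n m" "vec_dist p u v \<le> ?c"
    by (auto simp: chain_step_def)
  \<comment> \<open>By the dichotomy \<open>v\<close> lives strictly above \<open>k\<close>, hence
    shares no index with \<open>u\<close>.\<close>
  have "\<forall>j\<le>k. v j = 0"
    using factorization_dichotomy[OF k] fact(2) uv(3) unfolding m_def P_def by blast
  then have "vec_size p u \<le> vec_dist p u v"
    using uv(2) unfolding P_def by (intro vec_dist_disjoint_ge) (meson not_less)
  moreover have "b (Suc k) \<le> vec_size p u"
    using vec_size_lower_factorization_ge[OF k] fact(1) uv(2) unfolding m_def P_def by blast
  ultimately show ?thesis
    using fact(3) unfolding m_def by linarith
qed

end

section \<open>Combining the bounds over all elements of the semigroup\<close>

lemma mult_mem_generated: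
  assumes "g \<in> A"
  shows "c * g \<in> generated A"
proof (induction c)
  case 0
  then show ?case
    by (auto simp: generated_def hull_def additive_submonoid_def)
next
  case (Suc c)
  moreover have "g \<in> generated A"
    using assms by (simp add: generated_def hull_inc)
  ultimately show ?case
    by (auto simp: generated_def hull_def additive_submonoid_def)
qed

theorem theorem18:
  fixes S :: "nat set" and p :: nat and a b :: "nat \<Rightarrow> nat"
  assumes "NSCS S p a b"
  shows "semigroup_catenary_degree p (compound_seq p a b) S = enat (Max (b ` {1..p}))"
proof -
  let ?n = "compound_seq p a b"
  have params: "compound_params p a b" and S: "S = generated (?n ` {0..p})"
    using assms by (auto simp: NSCS_def minimal_generators_def)
  have "1 \<le> p"
    using params by (simp add: compound_params_def)
  then have "Max (b ` {1..p}) \<in> b ` {1..p}"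
    by (intro Max_in) auto
  then obtain i where "i \<in> {1..p}" "Max (b ` {1..p}) = b i"
    by blast
  then obtain k where k: "k < p" "Max (b ` {1..p}) = b (Suc k)"
    by (cases i) (auto simp: Suc_le_eq)
  \<comment> \<open>This multiple of a generator is an element at which the supremum attains the
    largest \<open>b i\<close>.\<close>
  have "b (Suc k) * ?n k \<in> S"
    unfolding S using k by (intro mult_mem_generated) auto
  then have "enat (b (Suc k)) \<le> semigroup_catenary_degree p ?n S"
    unfolding semigroup_catenary_degree_def
    using catenary_degree_ge[OF params k(1)] by (intro SUP_upper2) auto
  moreover have "semigroup_catenary_degree p ?n S \<le> enat (Max (b ` {1..p}))"
    unfolding semigroup_catenary_degree_def
    by (intro SUP_least) (auto intro!: catenary_degree_le[OF params])
  ultimately show ?thesis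
    using k(2) by (intro antisym) simp_all
qed

end
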